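(* Let $d\ge 2$. The real numbers $a_1, \dots, a_{d+1}$ with $a_1 + \cdots + a_{d+1} = 1$ occur as the barycentric coordinates of the orthocenter of a non-rectangular orthocentric $d$-simplex if and only if either all of them are positive, or exactly one of them is positive and the others are negative. Moreover, let $S$ be a non-rectangular orthocentric $d$-simplex whose orthocenter has barycentric coordinates $a_1,\dots,a_{d+1}$ with respect to $S$. In the first case (all $a_i>0$), $\sigma(S) < 0$ and all the vertex angles of $S$ are strongly acute. In the second case (exactly one $a_i$ positive, the others negative), $\sigma(S) > 0$, and one vertex angle of $S$ is strongly obtuse while the others are strongly acute.
   Context: A $d$-simplex $S=[A_1,\dots,A_{d+1}]$ in $\mathbb{E}^d$ is the convex hull of $d+1$ affinely independent points. $S$ is orthocentric if its altitudes (lines through each vertex perpendicular to the hyperplane of the opposite facet) have a common point, the orthocenter $H$; it is rectangular if $H$ is one of its vertices. The barycentric coordinates of $H$ are the unique reals with $H=\sum a_iA_i$, $\sum a_i=1$. For an orthocentric $S$, the obtuseness $\sigma(S)$ is the common value of $(H-A_i)\cdot(H-A_j)$ over $i\neq j$. A polyhedral angle with vertex $O$ and arms $OV_1,\dots,OV_n$ is called strongly acute (respectively strongly obtuse, right) if $\angle V_iOV_j$ is acute (respectively obtuse, right) for all $i\ne j$. The vertex angle of $S$ at $A_i$ is the polyhedral angle with vertex $A_i$ whose arms are the edges $A_iA_j$, $j\neq i$. *)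

theory Defs
  imports "HOL-Analysis.Analysis"
begin

text \<open>
  A simplex \<open>[A\<^sub>1, \<dots>, A\<^sub>d\<^sub>+\<^sub>1]\<close> is represented by its labelled vertices
  \<open>A 1, \<dots>, A (d + 1)\<close>, because barycentric coordinates refer to the labelling; values of
  \<open>A\<close> outside \<open>{1..d + 1}\<close> are irrelevant. The ambient space \<open>\<bbbE>\<^sup>d\<close> is a Euclidean space
  \<open>'a\<close> with \<open>DIM('a) = d\<close>; this equation is not part of the definitions but is assumed where
  they are used.
\<close>

definition simplex_vertices :: "nat \<Rightarrow> (nat \<Rightarrow> 'a::euclidean_space) \<Rightarrow> bool" where
  "simplex_vertices d A \<longleftrightarrow>
     inj_on A {1..d + 1} \<and> \<not> affine_dependent (A ` {1..d + 1})"

lemma simplex_vertices_imp_simplex: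
  assumes "simplex_vertices d A"
  shows "int d simplex (convex hull (A ` {1..d + 1}))"
  using assms unfolding simplex_vertices_def simplex_def
  by (intro exI[of _ "A ` {1..d + 1}"]) (auto simp: card_image)

definition facet_hyperplane :: "nat \<Rightarrow> (nat \<Rightarrow> 'a::euclidean_space) \<Rightarrow> nat \<Rightarrow> 'a set" where
  "facet_hyperplane d A i = affine hull (A ` ({1..d + 1} - {i}))"

text \<open>
  All points \<open>x\<close> such that \<open>x - A i\<close> is orthogonal to the direction space of the hyperplane of
  the facet opposite to \<open>A i\<close>. That direction space has dimension \<open>d - 1\<close>, so for
  \<open>DIM('a) = d\<close> this is the line through \<open>A i\<close> perpendicular to the hyperplane.
\<close>

definition altitude :: "nat \<Rightarrow> (nat \<Rightarrow> 'a::euclidean_space) \<Rightarrow> nat \<Rightarrow> 'a set" where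
  "altitude d A i =
     {x. \<forall>y \<in> facet_hyperplane d A i. \<forall>z \<in> facet_hyperplane d A i. orthogonal (x - A i) (y - z)}"

definition orthocentric :: "nat \<Rightarrow> (nat \<Rightarrow> 'a::euclidean_space) \<Rightarrow> bool" where
  "orthocentric d A \<longleftrightarrow> simplex_vertices d A \<and> (\<exists>H. \<forall>i \<in> {1..d + 1}. H \<in> altitude d A i)"

text \<open>
  The description is proper for orthocentric simplices when \<open>DIM('a) = d \<ge> 2\<close>; see
  \<open>orthocenter_unique\<close> and \<open>orthocenter_in_altitude\<close>.
\<close>

definition orthocenter :: "nat \<Rightarrow> (nat \<Rightarrow> 'a::euclidean_space) \<Rightarrow> 'a" where
  "orthocenter d A = (THE H. \<forall>i \<in> {1..d + 1}. H \<in> altitude d A i)"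

lemma orthocenter_unique:
  fixes A :: "nat \<Rightarrow> 'a::euclidean_space"
  assumes d: "DIM('a) = d" "2 \<le> d" and A: "simplex_vertices d A"
    and H: "\<forall>i \<in> {1..d + 1}. H \<in> altitude d A i"
    and H': "\<forall>i \<in> {1..d + 1}. H' \<in> altitude d A i"
  shows "H = H'"
proof -
  define v where "v = H - H'"
  have *: "v \<bullet> A j = v \<bullet> A k" if "j \<in> {1..d + 1}" "k \<in> {1..d + 1}" for j k
  proof -
    have "\<not> {1..3} \<subseteq> {j, k}"
    proof
      assume "{1..3} \<subseteq> {j, k}"
      then have "card {1..3::nat} \<le> card {j, k}" by (intro card_mono) simp_all
      also have "\<dots> \<le> 2" by (simp add: card_insert_if)
      finally show False by simp
    qed
    then obtain i where i: "i \<in> {1..3::nat}" "i \<noteq> j" "i \<noteq> k" by blast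
    then have "i \<in> {1..d + 1}" using d by auto
    moreover have "A j \<in> facet_hyperplane d A i" "A k \<in> facet_hyperplane d A i"
      unfolding facet_hyperplane_def using that i by (auto intro!: hull_inc)
    ultimately have "orthogonal (H - A i) (A j - A k)" "orthogonal (H' - A i) (A j - A k)"
      using H H' unfolding altitude_def by blast+
    then show ?thesis
      by (simp add: v_def orthogonal_def inner_diff_left inner_diff_right)
  qed
  have "aff_dim (A ` {1..d + 1}) = int DIM('a)"
    using A d aff_dim_affine_independent[of "A ` {1..d + 1}"]
    by (simp add: simplex_vertices_def card_image)
  then have hull: "affine hull (A ` {1..d + 1}) = UNIV"
    by (simp add: aff_dim_eq_full)
  have "affine hull (A ` {1..d + 1}) \<subseteq> {x. v \<bullet> x = v \<bullet> A 1}"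
  proof (rule hull_minimal)
    have "v \<bullet> A i = v \<bullet> A 1" if "i \<in> {1..d + 1}" for i
      by (rule *[OF that]) simp
    then show "A ` {1..d + 1} \<subseteq> {x. v \<bullet> x = v \<bullet> A 1}" by blast
  qed (rule affine_hyperplane)
  then have "v \<bullet> x = v \<bullet> A 1" for x using hull by blast
  then have "v \<bullet> v = v \<bullet> 0" by metis
  then show ?thesis by (simp add: v_def)
qed

lemma orthocenter_in_altitude:
  fixes A :: "nat \<Rightarrow> 'a::euclidean_space"
  assumes "DIM('a) = d" "2 \<le> d" "orthocentric d A" "i \<in> {1..d + 1}"
  shows "orthocenter d A \<in> altitude d A i"
proof -
  have "\<exists>!H. \<forall>i \<in> {1..d + 1}. H \<in> altitude d A i"
    using assms orthocenter_unique[of d A] unfolding orthocentric_def by blast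
  from theI'[OF this] show ?thesis using assms(4) unfolding orthocenter_def by blast
qed

definition rectangular :: "nat \<Rightarrow> (nat \<Rightarrow> 'a::euclidean_space) \<Rightarrow> bool" where
  "rectangular d A \<longleftrightarrow> orthocentric d A \<and> orthocenter d A \<in> A ` {1..d + 1}"

definition barycentric_coordinates ::
    "nat \<Rightarrow> (nat \<Rightarrow> 'a::euclidean_space) \<Rightarrow> 'a \<Rightarrow> (nat \<Rightarrow> real) \<Rightarrow> bool" where
  "barycentric_coordinates d A P a \<longleftrightarrow>
     (\<Sum>i \<in> {1..d + 1}. a i) = 1 \<and> P = (\<Sum>i \<in> {1..d + 1}. a i *\<^sub>R A i)"

definition obtuseness :: "nat \<Rightarrow> (nat \<Rightarrow> 'a::euclidean_space) \<Rightarrow> real" where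
  "obtuseness d A =
     (THE s. \<forall>i \<in> {1..d + 1}. \<forall>j \<in> {1..d + 1}. i \<noteq> j \<longrightarrow>
        (orthocenter d A - A i) \<bullet> (orthocenter d A - A j) = s)"

lemma obtuseness_eq:
  fixes A :: "nat \<Rightarrow> 'a::euclidean_space"
  assumes d: "DIM('a) = d" "2 \<le> d" and A: "orthocentric d A"
    and ij: "i \<in> {1..d + 1}" "j \<in> {1..d + 1}" "i \<noteq> j"
  shows "(orthocenter d A - A i) \<bullet> (orthocenter d A - A j) = obtuseness d A"
proof -
  define f where "f i j = (orthocenter d A - A i) \<bullet> (orthocenter d A - A j)" for i j
  have sym: "f i j = f j i" for i j by (simp add: f_def inner_commute)
  have step: "f i j = f i k"
    if "i \<in> {1..d + 1}" "j \<in> {1..d + 1}" "k \<in> {1..d + 1}" "i \<noteq> j" "i \<noteq> k" for i j k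
  proof -
    have "A j \<in> facet_hyperplane d A i" "A k \<in> facet_hyperplane d A i"
      unfolding facet_hyperplane_def using that by (auto intro!: hull_inc)
    with orthocenter_in_altitude[OF d A that(1)]
    have "orthogonal (orthocenter d A - A i) (A j - A k)" unfolding altitude_def by blast
    then show ?thesis by (simp add: f_def orthogonal_def inner_diff_right)
  qed
  have all: "f k l = f i j" if "k \<in> {1..d + 1}" "l \<in> {1..d + 1}" "k \<noteq> l" for k l
  proof (cases "k = j")
    case True
    have "f k l = f k i" using step[of k l i] that ij True by blast
    then show ?thesis using sym[of k i] True by simp
  next
    case False
    have "f k l = f k j" using step[of k l j] that ij False by blast
    also have "\<dots> = f j k" by (rule sym)
    also have "\<dots> = f j i" using step[of j k i] that ij False by blast
    also have "\<dots> = f i j" by (rule sym)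
    finally show ?thesis .
  qed
  have "obtuseness d A = f i j"
    unfolding obtuseness_def f_def[symmetric]
  proof (rule the_equality)
    show "\<forall>k \<in> {1..d + 1}. \<forall>l \<in> {1..d + 1}. k \<noteq> l \<longrightarrow> f k l = f i j" using all by blast
    show "s = f i j" if "\<forall>k \<in> {1..d + 1}. \<forall>l \<in> {1..d + 1}. k \<noteq> l \<longrightarrow> f k l = s" for s
      using that ij by blast
  qed
  then show ?thesis by (simp add: f_def)
qed

definition angle_at :: "'a::real_inner \<Rightarrow> 'a \<Rightarrow> 'a \<Rightarrow> real" where
  "angle_at V P W = arccos (((V - P) \<bullet> (W - P)) / (norm (V - P) * norm (W - P)))"

text \<open>
  A polyhedral angle is given by its vertex \<open>P\<close> and points \<open>V j\<close>, \<open>j \<in> J\<close>, on its arms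
  (with \<open>V j \<noteq> P\<close>). The vertex angle at \<open>A i\<close> has \<open>V = A\<close> and \<open>J = {1..d + 1} - {i}\<close>.
\<close>

definition strongly_acute :: "'a::real_inner \<Rightarrow> (nat \<Rightarrow> 'a) \<Rightarrow> nat set \<Rightarrow> bool" where
  "strongly_acute P V J \<longleftrightarrow> (\<forall>i \<in> J. \<forall>j \<in> J. i \<noteq> j \<longrightarrow> angle_at (V i) P (V j) < pi / 2)"

definition strongly_obtuse :: "'a::real_inner \<Rightarrow> (nat \<Rightarrow> 'a) \<Rightarrow> nat set \<Rightarrow> bool" where
  "strongly_obtuse P V J \<longleftrightarrow> (\<forall>i \<in> J. \<forall>j \<in> J. i \<noteq> j \<longrightarrow> angle_at (V i) P (V j) > pi / 2)"

definition vertex_angle_strongly_acute ::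
    "nat \<Rightarrow> (nat \<Rightarrow> 'a::euclidean_space) \<Rightarrow> nat \<Rightarrow> bool" where
  "vertex_angle_strongly_acute d A i \<longleftrightarrow> strongly_acute (A i) A ({1..d + 1} - {i})"

definition vertex_angle_strongly_obtuse ::
    "nat \<Rightarrow> (nat \<Rightarrow> 'a::euclidean_space) \<Rightarrow> nat \<Rightarrow> bool" where
  "vertex_angle_strongly_obtuse d A i \<longleftrightarrow> strongly_obtuse (A i) A ({1..d + 1} - {i})"

end

theory Submission
  imports Defs
begin

text \<open>
  Put the orthocenter \<open>H\<close> at the origin and write \<open>B\<^sub>i = A\<^sub>i - H\<close>. Being an orthocenter means that
  the Gram matrix of the \<open>B\<^sub>i\<close> has a constant off-diagonal entry \<open>\<sigma>\<close>, so it equals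
  \<open>\<sigma> J + diag (w\<^sub>1, \<dots>, w\<^sub>d\<^sub>+\<^sub>1)\<close>, where \<open>J\<close> is the all-one matrix and
  \<open>w\<^sub>i = B\<^sub>i \<bullet> B\<^sub>i - \<sigma>\<close>. Taking the inner product of \<open>\<Sum>j. a\<^sub>j B\<^sub>j = 0\<close> with \<open>B\<^sub>i\<close> gives
  \<open>a\<^sub>i w\<^sub>i = -\<sigma>\<close> (\<open>barycentric_obtuseness_relation\<close>). The numbers \<open>w\<^sub>i\<close> carry all the geometry
  needed: two edges from \<open>A\<^sub>i\<close> have inner product \<open>w\<^sub>i\<close>, and
  \<open>dist (A\<^sub>i) (A\<^sub>j)\<^sup>2 = w\<^sub>i + w\<^sub>j\<close>. Hence at most one \<open>w\<^sub>i\<close> fails to be positive, and the signs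
  of the \<open>a\<^sub>i\<close> follow from \<open>a\<^sub>i w\<^sub>i = -\<sigma>\<close> and \<open>\<Sum>i. a\<^sub>i = 1\<close>
  (\<open>orthocentric_sign_pattern\<close>). The sign of \<open>w\<^sub>i\<close> decides whether the vertex angle at \<open>A\<^sub>i\<close> is
  acute or obtuse.

  Conversely, let \<open>a\<^sub>k > 0\<close> and let all other \<open>a\<^sub>i\<close> have the same sign \<open>\<mu> = \<plusminus>1\<close>. The relation
  above forces \<open>w\<^sub>i = \<mu> / a\<^sub>i\<close> once \<open>\<sigma> = -\<mu>\<close> is fixed by scaling. The facet opposite to
  \<open>A\<^sub>k\<close> can be realised by pairwise orthogonal vectors \<open>A\<^sub>i\<close> of squared length \<open>w\<^sub>i > 0\<close>. Then
  \<open>A\<^sub>k\<close> and \<open>H\<close> are sought on the line through the origin along the normal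
  \<open>n = \<mu> (\<Sum>i\<noteq>k. a\<^sub>i A\<^sub>i)\<close> of that facet. The two unknown multiples of \<open>n\<close> are governed by a
  quadratic equation, which is solvable because \<open>a\<^sub>k > 0\<close> (\<open>exists_orthocentric_simplex\<close>).
\<close>

section \<open>Signs of angles and affine independence\<close>

lemma normalized_inner_bounds:
  fixes x y :: "'a::real_inner"
  shows "-1 \<le> (x \<bullet> y) / (norm x * norm y)" "(x \<bullet> y) / (norm x * norm y) \<le> 1"
proof -
  have "\<bar>(x \<bullet> y) / (norm x * norm y)\<bar> \<le> 1"
    using Cauchy_Schwarz_ineq2[of x y] by (auto simp: abs_mult divide_le_eq_1)
  then show "-1 \<le> (x \<bullet> y) / (norm x * norm y)" "(x \<bullet> y) / (norm x * norm y) \<le> 1"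
    by linarith+
qed

lemma angle_at_acute:
  fixes P V W :: "'a::real_inner"
  assumes "(V - P) \<bullet> (W - P) > 0"
  shows "angle_at V P W < pi / 2"
proof -
  have "V - P \<noteq> 0" "W - P \<noteq> 0" using assms by auto
  then have "0 < ((V - P) \<bullet> (W - P)) / (norm (V - P) * norm (W - P))"
    using assms by (intro divide_pos_pos mult_pos_pos) auto
  then have "angle_at V P W < arccos 0"
    unfolding angle_at_def by (intro arccos_less_arccos) (auto intro: normalized_inner_bounds)
  then show ?thesis by simp
qed

lemma angle_at_obtuse:
  fixes P V W :: "'a::real_inner"
  assumes "(V - P) \<bullet> (W - P) < 0"
  shows "angle_at V P W > pi / 2"
proof -
  have "V - P \<noteq> 0" "W - P \<noteq> 0" using assms by auto
  then have "((V - P) \<bullet> (W - P)) / (norm (V - P) * norm (W - P)) < 0"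
    using assms by (intro divide_neg_pos mult_pos_pos) auto
  then have "arccos 0 < angle_at V P W"
    unfolding angle_at_def by (intro arccos_less_arccos) (auto intro: normalized_inner_bounds)
  then show ?thesis by simp
qed

text \<open>
  A criterion in terms of the labels rather than the set of vertices. It also yields injectivity:
  if \<open>A i = A j\<close>, then the coefficients \<open>1\<close> at \<open>i\<close> and \<open>-1\<close> at \<open>j\<close> violate it.
\<close>

lemma simplex_verticesI:
  fixes A :: "nat \<Rightarrow> 'a::euclidean_space"
  assumes indep: "\<And>u i. (\<Sum>i \<in> {1..d + 1}. u i) = 0 \<Longrightarrow> (\<Sum>i \<in> {1..d + 1}. u i *\<^sub>R A i) = 0
    \<Longrightarrow> i \<in> {1..d + 1} \<Longrightarrow> u i = 0"
  shows "simplex_vertices d A"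
proof -
  let ?I = "{1..d + 1}"
  have inj: "inj_on A ?I"
  proof (rule inj_onI, rule ccontr)
    fix i j assume ij: "i \<in> ?I" "j \<in> ?I" "A i = A j" "i \<noteq> j"
    define u :: "nat \<Rightarrow> real" where
      "u l = (if l = i then 1 else 0) - (if l = j then 1 else 0)" for l
    have "(\<Sum>l \<in> ?I. u l) = 0"
      unfolding u_def sum_subtractf using ij by (simp add: sum.delta)
    moreover have "(\<Sum>l \<in> ?I. u l *\<^sub>R A l) = 0"
    proof -
      have "u l *\<^sub>R A l = (if l = i then A l else 0) - (if l = j then A l else 0)" for l
        by (simp add: u_def)
      then show ?thesis using ij by (simp add: sum_subtractf sum.delta)
    qed
    ultimately have "u i = 0" using indep ij(1) by blast
    then show False using ij(4) by (simp add: u_def)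
  qed
  have "\<not> affine_dependent (A ` ?I)"
  proof
    assume "affine_dependent (A ` ?I)"
    then obtain U v where U: "sum U (A ` ?I) = 0" "v \<in> A ` ?I" "U v \<noteq> 0"
        "(\<Sum>v \<in> A ` ?I. U v *\<^sub>R v) = 0"
      by (auto simp: affine_dependent_explicit_finite)
    from U(2) obtain i where i: "i \<in> ?I" "v = A i" by blast
    have "U (A i) = 0"
      
    proof (rule indep[of "\<lambda>l. U (A l)" i])
      show "(\<Sum>l \<in> ?I. U (A l)) = 0" "(\<Sum>l \<in> ?I. U (A l) *\<^sub>R A l) = 0"
        using U(1,4) unfolding sum.reindex[OF inj] o_def by blast+
    qed (rule i(1))
    with U(3) i(2) show False by simp
  qed
  with inj show ?thesis by (simp add: simplex_vertices_def)
qed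

section \<open>The Gram matrix of an orthocentric simplex\<close>

text \<open>
  The converse of the constancy of \<open>(H - A i) \<bullet> (H - A j)\<close>: since \<open>H - A i\<close> then has the same
  inner product with all vertices of the opposite facet, it is orthogonal to that facet.
\<close>

lemma in_altitude_if_constant_inner:
  fixes A :: "nat \<Rightarrow> 'a::euclidean_space"
  assumes "\<And>j. j \<in> {1..d + 1} \<Longrightarrow> j \<noteq> i \<Longrightarrow> (H - A i) \<bullet> (H - A j) = s"
  shows "H \<in> altitude d A i"
proof -
  let ?c = "(H - A i) \<bullet> H - s"
  have "facet_hyperplane d A i \<subseteq> {x. (H - A i) \<bullet> x = ?c}"
    unfolding facet_hyperplane_def
  proof (rule hull_minimal)
    show "A ` ({1..d + 1} - {i}) \<subseteq> {x. (H - A i) \<bullet> x = ?c}"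
      using assms by (force simp: inner_diff_right)
  qed (rule affine_hyperplane)
  then show ?thesis
    unfolding altitude_def orthogonal_def by (auto simp: inner_diff_right[of "H - A i"] subset_eq)
qed

lemma barycentric_obtuseness_relation:
  fixes A :: "nat \<Rightarrow> 'a::euclidean_space"
  assumes d: "DIM('a) = d" "2 \<le> d" and A: "orthocentric d A"
    and bary: "barycentric_coordinates d A (orthocenter d A) a"
    and i: "i \<in> {1..d + 1}"
  shows "a i * ((orthocenter d A - A i) \<bullet> (orthocenter d A - A i) - obtuseness d A)
    = - obtuseness d A"
proof -
  let ?I = "{1..d + 1}" and ?H = "orthocenter d A" and ?s = "obtuseness d A"
  have sum1: "sum a ?I = 1" and H: "?H = (\<Sum>j \<in> ?I. a j *\<^sub>R A j)"
    using bary by (auto simp: barycentric_coordinates_def)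
  have "(\<Sum>j \<in> ?I. a j *\<^sub>R (?H - A j)) = sum a ?I *\<^sub>R ?H - (\<Sum>j \<in> ?I. a j *\<^sub>R A j)"
    by (simp only: scaleR_right_diff_distrib sum_subtractf scaleR_left.sum)
  also have "\<dots> = 0" using sum1 H by simp
  finally have "0 = (?H - A i) \<bullet> (\<Sum>j \<in> ?I. a j *\<^sub>R (?H - A j))" by simp
  also have "\<dots> = (\<Sum>j \<in> ?I. a j * ((?H - A i) \<bullet> (?H - A j)))"
    by (simp only: inner_sum_right inner_scaleR_right)
  also have "\<dots> = a i * ((?H - A i) \<bullet> (?H - A i))
      + (\<Sum>j \<in> ?I - {i}. a j * ((?H - A i) \<bullet> (?H - A j)))"
    using i by (intro sum.remove) auto
  also have "(\<Sum>j \<in> ?I - {i}. a j * ((?H - A i) \<bullet> (?H - A j))) = (\<Sum>j \<in> ?I - {i}. a j * ?s)"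
  proof (intro sum.cong refl)
    fix j assume "j \<in> ?I - {i}"
    then have "(?H - A i) \<bullet> (?H - A j) = ?s"
      by (intro obtuseness_eq[OF d A i]) auto
    then show "a j * ((?H - A i) \<bullet> (?H - A j)) = a j * ?s" by simp
  qed
  also have "\<dots> = (1 - a i) * ?s"
    using sum.remove[OF _ i, of a] sum1 by (simp flip: sum_distrib_right)
  finally show ?thesis by (simp add: algebra_simps)
qed

lemma edge_inner_eq:
  fixes A :: "nat \<Rightarrow> 'a::euclidean_space"
  assumes d: "DIM('a) = d" "2 \<le> d" and A: "orthocentric d A"
    and ijk: "i \<in> {1..d + 1}" "j \<in> {1..d + 1}" "k \<in> {1..d + 1}" "i \<noteq> j" "i \<noteq> k" "j \<noteq> k"
  shows "(A j - A i) \<bullet> (A k - A i)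
    = (orthocenter d A - A i) \<bullet> (orthocenter d A - A i) - obtuseness d A"
proof -
  define B where "B l = orthocenter d A - A l" for l
  have "B i \<bullet> B j = obtuseness d A" "B i \<bullet> B k = obtuseness d A" "B j \<bullet> B k = obtuseness d A"
    unfolding B_def using ijk by (auto intro: obtuseness_eq[OF d A])
  moreover have "A j - A i = B i - B j" "A k - A i = B i - B k" by (simp_all add: B_def)
  ultimately show ?thesis
    by (simp add: inner_diff_left inner_diff_right inner_commute flip: B_def)
qed

text \<open>
  The sum of the quantities of \<open>edge_inner_eq\<close> at the two ends of an edge is its squared length.
\<close>

lemma edge_length_pos:
  fixes A :: "nat \<Rightarrow> 'a::euclidean_space"
  assumes d: "DIM('a) = d" "2 \<le> d" and A: "orthocentric d A"
    and ij: "i \<in> {1..d + 1}" "j \<in> {1..d + 1}" "i \<noteq> j"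
  shows "((orthocenter d A - A i) \<bullet> (orthocenter d A - A i) - obtuseness d A)
    + ((orthocenter d A - A j) \<bullet> (orthocenter d A - A j) - obtuseness d A) > 0"
proof -
  define B where "B l = orthocenter d A - A l" for l
  have s: "B i \<bullet> B j = obtuseness d A"
    unfolding B_def using ij by (auto intro: obtuseness_eq[OF d A])
  have "A i \<noteq> A j"
    using A ij inj_on_eq_iff[of A "{1..d + 1}" i j]
    by (simp add: orthocentric_def simplex_vertices_def)
  then have "0 < (B i - B j) \<bullet> (B i - B j)" by (simp add: B_def)
  also have "\<dots> = (B i \<bullet> B i - obtuseness d A) + (B j \<bullet> B j - obtuseness d A)"
    using s by (simp add: inner_diff_left inner_diff_right inner_commute)
  finally show ?thesis by (simp add: B_def)
qed

section \<open>The two sign patterns\<close>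

text \<open>
  If \<open>\<sigma> = 0\<close>, the relation between \<open>a i\<close> and \<open>\<sigma>\<close> says \<open>a i = 0\<close> or \<open>A i = H\<close>. The latter
  makes the simplex rectangular, and the former cannot hold for all \<open>i\<close>.
\<close>

lemma obtuseness_nonzero:
  fixes A :: "nat \<Rightarrow> 'a::euclidean_space"
  assumes d: "DIM('a) = d" "2 \<le> d" and A: "orthocentric d A" "\<not> rectangular d A"
    and bary: "barycentric_coordinates d A (orthocenter d A) a"
  shows "obtuseness d A \<noteq> 0"
proof
  assume s: "obtuseness d A = 0"
  have "a i = 0" if i: "i \<in> {1..d + 1}" for i
  proof -
    have "orthocenter d A \<noteq> A i" using A i by (auto simp: rectangular_def)
    then show ?thesis
      using barycentric_obtuseness_relation[OF d A(1) bary i] s by simp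
  qed
  then have "sum a {1..d + 1} = 0" by (intro sum.neutral) blast
  then show False using bary by (simp add: barycentric_coordinates_def)
qed

text \<open>
  By positivity of the squared edge lengths, no two indices \<open>i\<close> have \<open>-\<sigma> / a i \<le> 0\<close>.
  So for \<open>\<sigma> > 0\<close> at most one \<open>a i\<close> is positive, and one must be because the sum is \<open>1\<close>.
\<close>

lemma orthocentric_sign_pattern:
  fixes A :: "nat \<Rightarrow> 'a::euclidean_space"
  assumes d: "DIM('a) = d" "2 \<le> d" and A: "orthocentric d A" "\<not> rectangular d A"
    and bary: "barycentric_coordinates d A (orthocenter d A) a"
  shows "obtuseness d A < 0 \<and> (\<forall>i \<in> {1..d + 1}. a i > 0) \<or>
    obtuseness d A > 0 \<and> (\<exists>k \<in> {1..d + 1}. a k > 0 \<and> (\<forall>i \<in> {1..d + 1} - {k}. a i < 0))"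
proof -
  let ?I = "{1..d + 1}" and ?s = "obtuseness d A"
  define w where "w i = (orthocenter d A - A i) \<bullet> (orthocenter d A - A i) - ?s" for i
  have rel: "a i * w i = - ?s" if "i \<in> ?I" for i
    unfolding w_def by (rule barycentric_obtuseness_relation[OF d A(1) bary that])
  have s0: "?s \<noteq> 0" by (rule obtuseness_nonzero[OF d A bary])
  have a0: "a i \<noteq> 0" if "i \<in> ?I" for i using rel[OF that] s0 by auto
  have edge: "w i + w j > 0" if "i \<in> ?I" "j \<in> ?I" "i \<noteq> j" for i j
    unfolding w_def by (rule edge_length_pos[OF d A(1) that])
  show ?thesis
  proof (cases "?s < 0")
    case True
    have "a i > 0" if i: "i \<in> ?I" for i
    proof -
      have "w i > 0" using True inner_ge_zero[of "orthocenter d A - A i"]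
        unfolding w_def by linarith
      moreover have "a i * w i > 0" using rel[OF i] True by simp
      ultimately show ?thesis by (simp add: zero_less_mult_iff)
    qed
    then show ?thesis using True by blast
  next
    case False
    then have s: "?s > 0" using s0 by simp
    have neg: "w i < 0" if "i \<in> ?I" "a i > 0" for i
    proof -
      have "a i * w i < 0" using rel[OF that(1)] s by simp
      then show ?thesis using that(2) by (simp add: mult_less_0_iff)
    qed
    have "\<exists>k \<in> ?I. a k > 0"
    proof (rule ccontr)
      assume "\<not> ?thesis"
      then have "sum a ?I \<le> 0" by (intro sum_nonpos) (auto simp: not_less)
      then show False using bary by (simp add: barycentric_coordinates_def)
    qed
    then obtain k where k: "k \<in> ?I" "a k > 0" by blast
    have "a i < 0" if "i \<in> ?I - {k}" for i
      using that edge[of i k] neg[of i] neg[of k] k a0[of i] by force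
    then show ?thesis using s k by blast
  qed
qed

text \<open>
  The inner product of two edges from \<open>A i\<close> is \<open>-\<sigma> / a i\<close>, so the type of the vertex angle is
  read off from the signs of \<open>\<sigma>\<close> and \<open>a i\<close>.
\<close>

lemma vertex_angle_types:
  fixes A :: "nat \<Rightarrow> 'a::euclidean_space"
  assumes d: "DIM('a) = d" "2 \<le> d" and A: "orthocentric d A"
    and bary: "barycentric_coordinates d A (orthocenter d A) a"
    and i: "i \<in> {1..d + 1}"
  shows "obtuseness d A * a i < 0 \<Longrightarrow> vertex_angle_strongly_acute d A i"
    and "obtuseness d A * a i > 0 \<Longrightarrow> vertex_angle_strongly_obtuse d A i"
proof -
  let ?s = "obtuseness d A"
  define w where "w = (orthocenter d A - A i) \<bullet> (orthocenter d A - A i) - ?s"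
  have rel: "a i * w = - ?s"
    unfolding w_def by (rule barycentric_obtuseness_relation[OF d A bary i])
  have "?s = - (a i * w)" using rel by simp
  then have prod: "?s * a i = - ((a i * a i) * w)" by simp
  have inner: "(A j - A i) \<bullet> (A k - A i) = w"
    if "j \<in> {1..d + 1} - {i}" "k \<in> {1..d + 1} - {i}" "j \<noteq> k" for j k
    unfolding w_def using that i by (intro edge_inner_eq[OF d A]) auto
  show "vertex_angle_strongly_acute d A i" if "?s * a i < 0"
  proof -
    have "(a i * a i) * w > 0" using that unfolding prod by linarith
    then have "w > 0" by (simp add: zero_less_mult_iff[of "a i * a i"])
    then show ?thesis
      unfolding vertex_angle_strongly_acute_def strongly_acute_def
      using inner \<open>w > 0\<close> by (metis angle_at_acute)
  qed
  show "vertex_angle_strongly_obtuse d A i" if "?s * a i > 0"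
  proof -
    have "(a i * a i) * w < 0" using that unfolding prod by linarith
    then have "w < 0" by (simp add: mult_less_0_iff[of "a i * a i"])
    then show ?thesis
      unfolding vertex_angle_strongly_obtuse_def strongly_obtuse_def
      using inner \<open>w < 0\<close> by (metis angle_at_obtuse)
  qed
qed

section \<open>Construction of a simplex with prescribed coordinates\<close>

lemma exists_orthogonal_family:
  fixes w :: "nat \<Rightarrow> real"
  assumes "finite J" "card J = DIM('a)" "\<And>i. i \<in> J \<Longrightarrow> w i \<ge> 0"
  shows "\<exists>p :: nat \<Rightarrow> 'a::euclidean_space.
    \<forall>i \<in> J. \<forall>j \<in> J. p i \<bullet> p j = (if i = j then w i else 0)"
proof -
  obtain e where e: "bij_betw e J (Basis :: 'a set)"
    using finite_same_card_bij[of J "Basis :: 'a set"] assms(1,2) by auto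
  have "(sqrt (w i) *\<^sub>R e i) \<bullet> (sqrt (w j) *\<^sub>R e j) = (if i = j then w i else 0)"
    if "i \<in> J" "j \<in> J" for i j
  proof -
    have "e i \<in> Basis" "e j \<in> Basis"
      using bij_betw_apply[OF e] that by blast+
    moreover have "e i = e j \<longleftrightarrow> i = j"
      using e that by (intro inj_on_eq_iff) (simp_all add: bij_betw_imp_inj_on)
    ultimately have "e i \<bullet> e j = (if i = j then 1 else 0)" by (simp add: inner_Basis)
    then show ?thesis using assms(3)[OF that(1)] by auto
  qed
  then show ?thesis by (intro exI[of _ "\<lambda>i. sqrt (w i) *\<^sub>R e i"] ballI)
qed

text \<open>
  Write \<open>H = s n\<close> and \<open>A k = t n\<close> with \<open>n = \<mu> (\<Sum>i\<noteq>k. a i A i)\<close>; then \<open>n \<bullet> A i = 1\<close> for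
  \<open>i \<noteq> k\<close> and \<open>n \<bullet> n = \<mu> (1 - a k)\<close>. The barycentric condition is \<open>s = \<mu> + a k t\<close>, and
  orthogonality of \<open>H - A i\<close> and \<open>A k - A j\<close> is \<open>s t (n \<bullet> n) = s + t\<close>. Eliminating \<open>s\<close> leaves
  \<open>a k (1 - a k) \<mu> t\<^sup>2 - 2 a k t - \<mu> = 0\<close>, with discriminant \<open>4 a k\<close>; either of its two roots
  would do.
\<close>

lemma exists_orthocentric_simplex:
  fixes a :: "nat \<Rightarrow> real" and \<mu> :: real
  assumes d: "DIM('a::euclidean_space) = d" "2 \<le> d"
    and sum1: "(\<Sum>i \<in> {1..d + 1}. a i) = 1"
    and k: "k \<in> {1..d + 1}" "a k > 0"
    and mu: "\<mu> * \<mu> = 1" "\<And>i. i \<in> {1..d + 1} - {k} \<Longrightarrow> \<mu> * a i > 0"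
  shows "\<exists>A :: nat \<Rightarrow> 'a. orthocentric d A \<and> \<not> rectangular d A \<and>
    barycentric_coordinates d A (orthocenter d A) a"
proof -
  define I where "I = {1..d + 1}"
  define J where "J = I - {k}"
  note sum1 = sum1[folded I_def] and k = k[folded I_def] and mu = mu[folded I_def, folded J_def]
  have fin: "finite I" "finite J" by (simp_all add: I_def J_def)
  have card: "card J = DIM('a)" using k(1) d(1) by (simp add: I_def J_def)
  have apos: "\<mu> / a i > 0" if "i \<in> J" for i
    using mu(2)[OF that] by (simp add: zero_less_mult_iff zero_less_divide_iff)
  have "\<exists>p :: nat \<Rightarrow> 'a. \<forall>i \<in> J. \<forall>j \<in> J. p i \<bullet> p j = (if i = j then \<mu> / a i else 0)"
    using apos by (intro exists_orthogonal_family card fin(2)) (auto intro: less_imp_le)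
  then obtain p :: "nat \<Rightarrow> 'a" where
    p: "\<And>i j. i \<in> J \<Longrightarrow> j \<in> J \<Longrightarrow> p i \<bullet> p j = (if i = j then \<mu> / a i else 0)"
    by blast
  have lin: "p j \<bullet> (\<Sum>i \<in> J. c i *\<^sub>R p i) = c j * (\<mu> / a j)" if "j \<in> J" for j c
  proof -
    have "p j \<bullet> (\<Sum>i \<in> J. c i *\<^sub>R p i) = (\<Sum>i \<in> J. c i * (p j \<bullet> p i))"
      by (simp only: inner_sum_right inner_scaleR_right)
    also have "\<dots> = (\<Sum>i \<in> J. if i = j then c j * (\<mu> / a j) else 0)"
      using p[OF that] by (intro sum.cong) auto
    finally show ?thesis using that fin(2) by simp
  qed
  define n where "n = \<mu> *\<^sub>R (\<Sum>i \<in> J. a i *\<^sub>R p i)"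
  have pn: "p j \<bullet> n = 1" if "j \<in> J" for j
    using lin[OF that, of a] apos[OF that] mu(1) by (auto simp: n_def)
  have sumJ: "sum a J = 1 - a k"
    using sum.remove[OF fin(1) k(1), of a, folded J_def] sum1 by simp
  have "n \<bullet> n = \<mu> * (\<Sum>i \<in> J. a i * (p i \<bullet> n))"
    by (subst (1) n_def) (simp only: inner_sum_left inner_scaleR_left)
  also have "(\<Sum>i \<in> J. a i * (p i \<bullet> n)) = sum a J" using pn by (intro sum.cong) auto
  finally have nn: "n \<bullet> n = \<mu> * (1 - a k)" by (simp add: sumJ)

  \<comment> \<open>\<open>t\<close> is one root of the quadratic equation, and \<open>s = \<mu> + a k t\<close>, both in terms of \<open>\<surd>(a k)\<close>.\<close>
  define r where "r = sqrt (a k)"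
  have r: "r > 0" "a k = r * r" using k(2) by (auto simp: r_def)
  define s where "s = \<mu> / (1 + r)"
  define t where "t = - \<mu> / (r * (1 + r))"
  have mu0: "\<mu> \<noteq> 0" using mu(1) by auto
  have st: "\<mu> + a k * t = s" "s - t = \<mu> / r"
    using r(1) by (auto simp: s_def t_def r(2) divide_simps) (auto simp: algebra_simps)
  have sn: "s * (n \<bullet> n) = 1 - r"
  proof -
    have "s * (n \<bullet> n) = (\<mu> * \<mu>) * ((1 - r * r) / (1 + r))"
      by (simp add: s_def nn r(2))
    also have "\<dots> = 1 - r" using mu(1) r(1) by (simp add: divide_simps algebra_simps)
    finally show ?thesis .
  qed
  have tn: "t * (n \<bullet> n) = 1 - 1 / r"
  proof -
    have "t * (n \<bullet> n) = (\<mu> * \<mu>) * (- ((1 - r * r) / (r * (1 + r))))"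
      by (simp add: t_def nn r(2))
    also have "\<dots> = 1 - 1 / r" using mu(1) r(1) by (simp add: divide_simps) (simp add: algebra_simps)
    finally show ?thesis .
  qed
  define A where "A = p(k := t *\<^sub>R n)"
  define H where "H = s *\<^sub>R n"
  have A[simp]: "A k = t *\<^sub>R n" "\<And>i. i \<in> J \<Longrightarrow> A i = p i" by (auto simp: A_def J_def)
  have np: "n \<bullet> p j = 1" if "j \<in> J" for j using pn[OF that] by (simp add: inner_commute)

  have simplex: "simplex_vertices d A"
  proof (rule simplex_verticesI, fold I_def)
    fix u i assume u: "sum u I = 0" "(\<Sum>i \<in> I. u i *\<^sub>R A i) = 0" and i: "i \<in> I"
    have "(\<Sum>i \<in> J. u i *\<^sub>R A i) = (\<Sum>i \<in> J. u i *\<^sub>R p i)" by (intro sum.cong) auto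
    then have eq: "(u k * t) *\<^sub>R n + (\<Sum>i \<in> J. u i *\<^sub>R p i) = 0"
      using sum.remove[OF fin(1) k(1), of "\<lambda>i. u i *\<^sub>R A i", folded J_def] u(2) by simp
    have uj: "u j = - (u k * t) * (\<mu> * a j)" if j: "j \<in> J" for j
    proof -
      have "0 = p j \<bullet> ((u k * t) *\<^sub>R n + (\<Sum>i \<in> J. u i *\<^sub>R p i))" by (simp add: eq)
      also have "\<dots> = u k * t + u j * (\<mu> / a j)"
        by (simp only: inner_add_right inner_scaleR_right pn[OF j] lin[OF j] mult_1_right)
      finally have *: "u j * (\<mu> / a j) = - (u k * t)" by simp
      have "u j = (u j * (\<mu> / a j)) * (\<mu> * a j)"
        using mu(1) apos[OF j] by auto
      then show ?thesis by (simp only: *)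
    qed
    have "sum u J = (\<Sum>j \<in> J. - (u k * t) * (\<mu> * a j))" using uj by (intro sum.cong) auto
    also have "\<dots> = - (u k * (t * (n \<bullet> n)))"
      by (simp add: nn sumJ[symmetric] sum_distrib_left sum_negf mult.assoc)
    also have "\<dots> = - u k + u k / r" by (simp add: tn algebra_simps)
    finally have "u k / r = 0" using sum.remove[OF fin(1) k(1), of u, folded J_def] u(1) by simp
    then have "u k = 0" using r(1) by simp
    then show "u i = 0" using uj[of i] i by (cases "i = k") (auto simp: J_def)
  qed

  have gram_J: "(H - A i) \<bullet> (H - A j) = - \<mu>" if "i \<in> J" "j \<in> J" "i \<noteq> j" for i j
  proof -
    have "(H - A i) \<bullet> (H - A j) = s * (s * (n \<bullet> n)) - 2 * s"
      using that p[OF that(1,2)]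
      by (simp add: H_def inner_diff_left inner_diff_right pn[OF that(1)] np[OF that(2)]
          algebra_simps)
    also have "\<dots> = - (s * (1 + r))" by (simp add: sn algebra_simps)
    also have "\<dots> = - \<mu>" using r(1) by (simp add: s_def)
    finally show ?thesis .
  qed
  have gram_k: "(H - A k) \<bullet> (H - A j) = - \<mu>" if "j \<in> J" for j
  proof -
    have "(H - A k) \<bullet> (H - A j) = ((s - t) *\<^sub>R n) \<bullet> (s *\<^sub>R n - p j)"
      using that by (simp add: H_def scaleR_left_diff_distrib)
    also have "\<dots> = (s - t) * (s * (n \<bullet> n) - 1)"
      by (simp add: inner_diff_right np[OF that] algebra_simps)
    also have "\<dots> = - \<mu>" using r(1) by (simp add: sn st)
    finally show ?thesis .
  qed
  have gram: "(H - A i) \<bullet> (H - A j) = - \<mu>" if "i \<in> I" "j \<in> I" "j \<noteq> i" for i j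
    using gram_J[of i j] gram_k[of j] gram_k[of i] that
    by (cases "i = k"; cases "j = k") (auto simp: J_def inner_commute)
  have alt: "\<forall>i \<in> I. H \<in> altitude d A i"
    unfolding I_def by (intro ballI in_altitude_if_constant_inner[where s = "- \<mu>"] gram[unfolded I_def])
  then have orth: "orthocentric d A" using simplex by (auto simp: orthocentric_def I_def)
  have H_eq: "orthocenter d A = H"
    using orthocenter_unique[OF d simplex] orthocenter_in_altitude[OF d orth] alt
    unfolding I_def by blast
  have "\<not> rectangular d A"
  proof
    assume "rectangular d A"
    then obtain i where i: "i \<in> I" "H = A i" by (auto simp: rectangular_def H_eq I_def)
    obtain j where "j \<in> I" "j \<noteq> i"
      using d(2) i(1) by (cases "i = 1") (auto simp: I_def intro: that[of 1] that[of 2])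
    then show False using gram[OF i(1)] i(2) mu0 by auto
  qed
  moreover have "barycentric_coordinates d A H a"
  proof -
    have "(\<Sum>i \<in> J. a i *\<^sub>R A i) = (\<Sum>i \<in> J. a i *\<^sub>R p i)" by (intro sum.cong) auto
    also have "\<dots> = (\<mu> * \<mu>) *\<^sub>R (\<Sum>i \<in> J. a i *\<^sub>R p i)" by (simp add: mu(1))
    also have "\<dots> = \<mu> *\<^sub>R n" by (simp add: n_def)
    finally have "(\<Sum>i \<in> I. a i *\<^sub>R A i) = (\<mu> + a k * t) *\<^sub>R n"
      using sum.remove[OF fin(1) k(1), of "\<lambda>i. a i *\<^sub>R A i", folded J_def] by (simp add: scaleR_left_distrib)
    then show ?thesis using sum1
      by (simp only: barycentric_coordinates_def H_def st I_def[symmetric] simp_thms)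
  qed
  ultimately show ?thesis using orth H_eq by metis
qed

section \<open>Orthocenters of non-rectangular orthocentric simplices\<close>

theorem theorem3p8:
  fixes d :: nat and a :: "nat \<Rightarrow> real"
  assumes "d \<ge> 2" and "DIM('a::euclidean_space) = d"
    and "(\<Sum>i \<in> {1..d + 1}. a i) = 1"
  shows
    "((\<exists>A :: nat \<Rightarrow> 'a. orthocentric d A \<and> \<not> rectangular d A \<and>
          barycentric_coordinates d A (orthocenter d A) a)
      \<longleftrightarrow>
        (\<forall>i \<in> {1..d + 1}. a i > 0) \<or>
        (\<exists>k \<in> {1..d + 1}. a k > 0 \<and> (\<forall>i \<in> {1..d + 1} - {k}. a i < 0)))
     \<and>
     (\<forall>A :: nat \<Rightarrow> 'a. orthocentric d A \<and> \<not> rectangular d A \<and>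
          barycentric_coordinates d A (orthocenter d A) a \<longrightarrow>
        ((\<forall>i \<in> {1..d + 1}. a i > 0) \<longrightarrow>
           obtuseness d A < 0 \<and> (\<forall>i \<in> {1..d + 1}. vertex_angle_strongly_acute d A i)) \<and>
        ((\<exists>k \<in> {1..d + 1}. a k > 0 \<and> (\<forall>i \<in> {1..d + 1} - {k}. a i < 0)) \<longrightarrow>
           obtuseness d A > 0 \<and>
           (\<exists>k \<in> {1..d + 1}. vertex_angle_strongly_obtuse d A k \<and>
              (\<forall>i \<in> {1..d + 1} - {k}. vertex_angle_strongly_acute d A i))))"
proof -
  let ?I = "{1..d + 1}"
  let ?pos = "\<forall>i \<in> ?I. a i > 0"
  let ?one = "\<exists>k \<in> ?I. a k > 0 \<and> (\<forall>i \<in> ?I - {k}. a i < 0)"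
  note d = assms(2) assms(1)
  \<comment> \<open>Because \<open>d \<ge> 2\<close>, some index differs from the \<open>k\<close> of the second pattern.\<close>
  have excl: False if pos: ?pos and one: ?one
  proof -
    from one obtain k where k: "\<forall>i \<in> ?I - {k}. a i < 0" by blast
    obtain i where "i \<in> ?I - {k}"
      using d by (cases "k = 1") (auto intro: that[of 1] that[of 2])
    then show False using k pos by force
  qed
  have "\<exists>A :: nat \<Rightarrow> 'a. orthocentric d A \<and> \<not> rectangular d A \<and>
      barycentric_coordinates d A (orthocenter d A) a" if "?pos \<or> ?one"
    using that
  proof
    assume ?pos
    then show ?thesis by (intro exists_orthocentric_simplex[OF d assms(3), of 1 1]) auto
  next
    assume ?one
    then obtain k where "k \<in> ?I" "a k > 0" "\<forall>i \<in> ?I - {k}. a i < 0" by blast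
    then show ?thesis by (intro exists_orthocentric_simplex[OF d assms(3), of k "-1"]) auto
  qed
  moreover have "?pos \<or> ?one"
    if "orthocentric d A" "\<not> rectangular d A" "barycentric_coordinates d A (orthocenter d A) a"
    for A :: "nat \<Rightarrow> 'a"
    using orthocentric_sign_pattern[OF d that] by blast
  moreover have "(?pos \<longrightarrow> obtuseness d A < 0 \<and> (\<forall>i \<in> ?I. vertex_angle_strongly_acute d A i)) \<and>
      (?one \<longrightarrow> obtuseness d A > 0 \<and> (\<exists>k \<in> ?I. vertex_angle_strongly_obtuse d A k \<and>
        (\<forall>i \<in> ?I - {k}. vertex_angle_strongly_acute d A i)))"
    if A: "orthocentric d A" "\<not> rectangular d A"
      and bary: "barycentric_coordinates d A (orthocenter d A) a" for A :: "nat \<Rightarrow> 'a"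
  proof (intro conjI impI)
    note angles = vertex_angle_types[OF d A(1) bary]
    {
      assume ?pos
      then show s: "obtuseness d A < 0"
        using orthocentric_sign_pattern[OF d A bary] excl by blast
      show "\<forall>i \<in> ?I. vertex_angle_strongly_acute d A i"
        using \<open>?pos\<close> s by (auto intro!: angles(1) mult_neg_pos)
    next
      assume one: ?one
      then show s: "obtuseness d A > 0"
        using orthocentric_sign_pattern[OF d A bary] excl by blast
      from one obtain k where k: "k \<in> ?I" "a k > 0" "\<forall>i \<in> ?I - {k}. a i < 0" by blast
      have "vertex_angle_strongly_obtuse d A k" using k s by (intro angles(2)) auto
      moreover have "\<forall>i \<in> ?I - {k}. vertex_angle_strongly_acute d A i"
        using k s by (auto intro!: angles(1) mult_pos_neg)
      ultimately show "\<exists>k \<in> ?I. vertex_angle_strongly_obtuse d A k \<and>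
          (\<forall>i \<in> ?I - {k}. vertex_angle_strongly_acute d A i)"
        using k(1) by blast
    }
  qed
  ultimately show ?thesis by blast
qed

end
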